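(* Let $X$ be a finite skew brace. Then the following statements hold. (1) The left-nilpotent residual is the ideal generated by the final term of the left series: $\mathfrak{R}_L(X)=\operatorname{Id}_X\bigl(L_\infty(X)\bigr)$. (2) The quotient $X/\mathfrak{R}_L(X)$ is the largest left-nilpotent quotient of $X$. More precisely, $X/\mathfrak{R}_L(X)$ is left nilpotent, and if $f:X\to Y$ is an epimorphism of skew braces and $Y$ is left nilpotent, then $\mathfrak{R}_L(X)\leq\ker f$. (3) $L_\infty(X)\leq\mathfrak{R}_L(X)\leq X^2$. (4) The equality $\mathfrak{R}_L(X)=0$ holds if and only if $X$ is left nilpotent, and $\mathfrak{R}_L(X)=L_\infty(X)$ holds if and only if $L_\infty(X)$ is an ideal of $X$.
   Context: A skew (left) brace is a triple $X=(X,+,\cdot)$ such that $(X,+)$ and $(X,\cdot)$ are groups (not necessarily abelian) on the same set and $a\cdot(b+c)=a\cdot b-a+a\cdot c$ for all $a,b,c\in X$. The common identity is denoted $0$. Put $\lambda_a(b)=-a+a\cdot b$ (each $\lambda_a$ is an automorphism of $(X,+)$) and $a*b=\lambda_a(b)-b=-a+a\cdot b-b$. For subsets $S,T\subseteq X$, $S*T$ is the subgroup of $(X,+)$ generated by all $s*t$ with $s\in S$, $t\in T$. An ideal of $X$ is a subgroup of $(X,+)$ that is invariant under every $\lambda_a$ and normal in both $(X,+)$ and $(X,\cdot)$; quotients $X/I$ by ideals are skew braces. $\operatorname{Id}_X(S)$ is the smallest ideal of $X$ containing the subset $S$. The left series is $X^1=X$, $X^{n+1}=X*X^n$ ($n\ge1$);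 $X$ is left nilpotent if $X^n=0$ for some $n$. The final term of the left series is $L_\infty(X)=\bigcap_{n\ge1}X^n$. The left-nilpotent residual is $\mathfrak{R}_L(X)=\bigcap\{I: I\text{ is an ideal of }X\text{ and }X/I\text{ is left nilpotent}\}$. *)

theory Defs
  imports "HOL-Algebra.QuotRing" "HOL-Algebra.Generated_Groups"
begin

text \<open>
  A skew brace is carried by the ring record of HOL-Algebra: the additive group is
  \<open>add_monoid X\<close> (operation \<open>\<oplus>\<close>, identity \<open>\<zero>\<close>), the multiplicative group is \<open>X\<close> itself, viewed
  as a monoid (operation \<open>\<otimes>\<close>, identity \<open>\<one>\<close>). Neither group is assumed to be abelian.
  The two identities coincide as a consequence of the axioms (lemma \<open>one_eq_zero\<close>).
\<close>

locale skew_brace =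
  fixes X (structure)
  assumes add_group: "group (add_monoid X)"
    and mult_group: "group X"
    and skew_distrib:
      "\<lbrakk>a \<in> carrier X; b \<in> carrier X; c \<in> carrier X\<rbrakk>
        \<Longrightarrow> a \<otimes> (b \<oplus> c) = ((a \<otimes> b) \<ominus> a) \<oplus> (a \<otimes> c)"

definition brace_lambda :: "('a, 'm) ring_scheme \<Rightarrow> 'a \<Rightarrow> 'a \<Rightarrow> 'a" where
  "brace_lambda X a b = (\<ominus>\<^bsub>X\<^esub> a) \<oplus>\<^bsub>X\<^esub> (a \<otimes>\<^bsub>X\<^esub> b)"

definition brace_star :: "('a, 'm) ring_scheme \<Rightarrow> 'a \<Rightarrow> 'a \<Rightarrow> 'a" where
  "brace_star X a b = brace_lambda X a b \<ominus>\<^bsub>X\<^esub> b"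

definition set_star :: "('a, 'm) ring_scheme \<Rightarrow> 'a set \<Rightarrow> 'a set \<Rightarrow> 'a set" where
  "set_star X S T = generate (add_monoid X) {brace_star X s t | s t. s \<in> S \<and> t \<in> T}"

definition brace_ideal :: "'a set \<Rightarrow> ('a, 'm) ring_scheme \<Rightarrow> bool" where
  "brace_ideal I X \<longleftrightarrow>
     subgroup I (add_monoid X) \<and>
     (\<forall>a\<in>carrier X. brace_lambda X a ` I \<subseteq> I) \<and>
     I \<lhd> add_monoid X \<and>
     I \<lhd> X"

definition ideal_generated :: "('a, 'm) ring_scheme \<Rightarrow> 'a set \<Rightarrow> 'a set" where
  "ideal_generated X S = \<Inter> {I. brace_ideal I X \<and> S \<subseteq> I}"

text \<open>
  The indexing is that of the usual notation, so the series starts at index 1;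
  the value at index 0 is a dummy.
\<close>

fun left_series :: "('a, 'm) ring_scheme \<Rightarrow> nat \<Rightarrow> 'a set" where
  "left_series X 0 = carrier X"
| "left_series X (Suc 0) = carrier X"
| "left_series X (Suc (Suc n)) = set_star X (carrier X) (left_series X (Suc n))"

definition left_nilpotent :: "('a, 'm) ring_scheme \<Rightarrow> bool" where
  "left_nilpotent X \<longleftrightarrow> (\<exists>n\<ge>1. left_series X n = {\<zero>\<^bsub>X\<^esub>})"

definition left_series_final :: "('a, 'm) ring_scheme \<Rightarrow> 'a set" where
  "left_series_final X = (\<Inter>n\<in>{1..}. left_series X n)"

text \<open>
  The quotient is the library's \<open>X Quot I\<close>: additive cosets of \<open>I\<close>, with the sum of cosets and the
  product \<open>(I + a)(I + b) = I + ab\<close>. Its definition does not use the ring axioms, and it is a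
  skew brace for every ideal \<open>I\<close> of a skew brace (lemma \<open>quotient_skew_brace\<close>).
\<close>

definition left_nilpotent_residual :: "('a, 'm) ring_scheme \<Rightarrow> 'a set" where
  "left_nilpotent_residual X = \<Inter> {I. brace_ideal I X \<and> left_nilpotent (X Quot I)}"

definition brace_epi :: "('a, 'm) ring_scheme \<Rightarrow> ('b, 'n) ring_scheme \<Rightarrow> ('a \<Rightarrow> 'b) set" where
  "brace_epi X Y = epi (add_monoid X) (add_monoid Y) \<inter> epi X Y"

context skew_brace
begin

sublocale A: group "add_monoid X"
  rewrites "carrier (add_monoid X) = carrier X"
    and "mult (add_monoid X) = add X"
    and "one (add_monoid X) = zero X"
    and "m_inv (add_monoid X) = a_inv X"
  by (rule add_group) (simp_all add: a_inv_def)

sublocale M: group X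
  by (rule mult_group)

lemma one_eq_zero: "\<one> = \<zero>"
proof -
  have "\<zero> = (\<zero> \<ominus> \<one>) \<oplus> \<zero>"
    using skew_distrib[of \<one> \<zero> \<zero>] by simp
  then have "\<zero> = \<ominus> \<one>"
    by (simp add: a_minus_def)
  then show ?thesis
    using A.inv_inv[of \<one>] A.inv_one by simp
qed

lemma mult_eq_add_lambda:
  assumes "a \<in> carrier X" "b \<in> carrier X"
  shows "a \<otimes> b = a \<oplus> brace_lambda X a b"
  using assms by (simp add: brace_lambda_def A.m_assoc[symmetric])

lemma brace_lambda_inv:
  assumes "a \<in> carrier X" "b \<in> carrier X"
  shows "brace_lambda X a (brace_lambda X (inv a) b) = b"
proof -
  let ?a = "inv a"
  have c: "?a \<in> carrier X" "\<ominus> ?a \<in> carrier X" "a \<otimes> \<ominus> ?a \<in> carrier X"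
    using assms by auto
  have "a = (a \<otimes> \<ominus> ?a \<ominus> a) \<oplus> \<zero>"
    using skew_distrib[of a "\<ominus> ?a" ?a] assms c M.r_one[of a] by (simp add: one_eq_zero)
  then have "a = a \<otimes> \<ominus> ?a \<ominus> a"
    using assms c by (simp add: a_minus_def)
  moreover have "a \<otimes> (\<ominus> ?a \<oplus> ?a \<otimes> b) = (a \<otimes> \<ominus> ?a \<ominus> a) \<oplus> b"
    using skew_distrib[of a "\<ominus> ?a" "?a \<otimes> b"] assms c
    by (simp add: M.m_assoc[symmetric] one_eq_zero[symmetric])
  ultimately have "a \<otimes> (\<ominus> ?a \<oplus> ?a \<otimes> b) = a \<oplus> b" by simp
  then show ?thesis
    using assms by (simp add: brace_lambda_def A.m_assoc[symmetric])
qed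

lemma quotient_skew_brace:
  assumes I: "brace_ideal I X"
  shows "skew_brace (X Quot I)"
proof -
  interpret NA: normal I "add_monoid X" using I by (simp add: brace_ideal_def)
  interpret NM: normal I X using I by (simp add: brace_ideal_def)
  have IX: "I \<subseteq> carrier X" using NM.subset .
  have cos: "I +> x = I #> x" if x: "x \<in> carrier X" for x
  proof -
    have "I +> x = x <+ I" using NA.coset_eq x by (simp add: a_r_coset_def a_l_coset_def)
    also have "\<dots> = x <# I"
    proof
      show "x <+ I \<subseteq> x <# I"
      proof
        fix y assume "y \<in> x <+ I"
        then obtain i where i: "i \<in> I" "y = x \<oplus> i"
          by (auto simp: a_l_coset_def l_coset_def)
        let ?j = "brace_lambda X (inv x) i"
        have j: "?j \<in> I" using I i(1) x by (auto simp: brace_ideal_def)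
        then have "y = x \<otimes> ?j"
          using i x IX mult_eq_add_lambda[of x ?j] brace_lambda_inv[of x i] by auto
        then show "y \<in> x <# I" using j by (auto simp: l_coset_def)
      qed
      show "x <# I \<subseteq> x <+ I"
      proof
        fix y assume "y \<in> x <# I"
        then obtain i where i: "i \<in> I" "y = x \<otimes> i"
          by (auto simp: l_coset_def)
        have j: "brace_lambda X x i \<in> I" using I i(1) x by (auto simp: brace_ideal_def)
        have "y = x \<oplus> brace_lambda X x i"
          using i x IX mult_eq_add_lambda[of x i] by auto
        then show "y \<in> x <+ I" using j by (auto simp: a_l_coset_def l_coset_def)
      qed
    qed
    also have "\<dots> = I #> x" using NM.coset_eq x by simp
    finally show ?thesis .
  qed
  have repr: "I +> z = I +> w" if "w \<in> carrier X" "z \<in> I +> w" for z w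
    using that A.repr_independence[of z I w] NA.subgroup_axioms by (simp add: a_r_coset_def)
  have self: "x \<in> I +> x" if "x \<in> carrier X" for x
    using that A.rcos_self[of x I] NA.subgroup_axioms by (simp add: a_r_coset_def)
  have madd: "set_add X (I +> x) (I +> y) = I +> (x \<oplus> y)"
    if "x \<in> carrier X" "y \<in> carrier X" for x y
    using that NA.rcos_sum[of x y] by (simp add: a_r_coset_def set_add_def)
  have mmul: "rcoset_mult X I (I +> x) (I +> y) = I +> (x \<otimes> y)"
    if x: "x \<in> carrier X" and y: "y \<in> carrier X" for x y
  proof -
    have "I +> (a \<otimes> b) = I +> (x \<otimes> y)" if "a \<in> I +> x" "b \<in> I +> y" for a b
    proof -
      have "a \<otimes> b \<in> (I #> x) <#> (I #> y)"
        using that cos x y by (auto simp: set_mult_def)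
      then have "a \<otimes> b \<in> I +> (x \<otimes> y)" using NM.rcos_sum[OF x y] cos x y by simp
      then show ?thesis using repr[of "x \<otimes> y" "a \<otimes> b"] M.m_closed[OF x y] by blast
    qed
    then show ?thesis unfolding rcoset_mult_def using self x y by blast
  qed
  have car: "carrier (X Quot I) = (+>) I ` carrier X"
    by (auto simp: FactRing_def A_RCOSETS_def RCOSETS_def a_r_coset_def)
  have zer: "I +> \<zero> = I"
    using IX by (simp add: a_r_coset_def A.coset_mult_one)
  have homA: "(+>) I \<in> hom (add_monoid X) (add_monoid (X Quot I))"
    by (rule homI) (use car madd in \<open>auto simp: FactRing_def\<close>)
  have homM: "(+>) I \<in> hom X (X Quot I)"
    by (rule homI) (use car mmul in \<open>auto simp: FactRing_def\<close>)
  have gA: "group (add_monoid (X Quot I))"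
    using group.hom_imp_img_group[OF add_group homA] car zer by (simp add: FactRing_def)
  have gM: "group (X Quot I)"
    using M.hom_imp_img_group[OF homM] car by (simp add: FactRing_def)
  have ainv: "a_inv (X Quot I) (I +> x) = I +> (\<ominus> x)" if "x \<in> carrier X" for x
    using group_hom.hom_inv[of "add_monoid X" "add_monoid (X Quot I)" "(+>) I" x]
      homA gA add_group that
    by (simp add: group_hom_def group_hom_axioms_def a_inv_def)
  show ?thesis
  proof (rule skew_brace.intro[OF gA gM])
    fix A B C
    assume "A \<in> carrier (X Quot I)" "B \<in> carrier (X Quot I)" "C \<in> carrier (X Quot I)"
    then obtain a b c where abc: "a \<in> carrier X" "b \<in> carrier X" "c \<in> carrier X"
      "A = I +> a" "B = I +> b" "C = I +> c" using car by auto
    have s: "mult (X Quot I) = rcoset_mult X I" "add (X Quot I) = set_add X"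
      by (simp_all add: FactRing_def)
    show "A \<otimes>\<^bsub>X Quot I\<^esub> (B \<oplus>\<^bsub>X Quot I\<^esub> C)
      = A \<otimes>\<^bsub>X Quot I\<^esub> B \<ominus>\<^bsub>X Quot I\<^esub> A \<oplus>\<^bsub>X Quot I\<^esub> (A \<otimes>\<^bsub>X Quot I\<^esub> C)"
      unfolding a_minus_def s abc(4-6) ainv[OF abc(1)]
      using abc(1-3) skew_distrib[of a b c] by (simp add: mmul madd a_minus_def)
  qed
qed

lemma brace_ideal_carrier: "brace_ideal (carrier X) X"
proof -
  have "brace_lambda X a ` carrier X \<subseteq> carrier X" if "a \<in> carrier X" for a
    using that by (auto simp: brace_lambda_def)
  moreover have "carrier X \<lhd> add_monoid X" "carrier X \<lhd> X"
    using A.normal_inv_iff[of "carrier X"] A.subgroup_self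
      M.normal_inv_iff[of "carrier X"] M.subgroup_self by auto
  ultimately show ?thesis
    using normal_imp_subgroup by (auto simp: brace_ideal_def)
qed

lemma brace_ideal_Inter:
  assumes "\<And>I. I \<in> F \<Longrightarrow> brace_ideal I X" "F \<noteq> {}"
  shows "brace_ideal (\<Inter>F) X"
proof -
  have sA: "subgroup (\<Inter>F) (add_monoid X)"
    using assms by (intro A.subgroups_Inter) (auto simp: brace_ideal_def)
  have sM: "subgroup (\<Inter>F) X"
    using assms by (intro M.subgroups_Inter) (auto simp: brace_ideal_def intro: normal_imp_subgroup)
  have "\<Inter>F \<lhd> add_monoid X" "\<Inter>F \<lhd> X"
    using sA sM assms(1) by (auto simp: A.normal_inv_iff M.normal_inv_iff brace_ideal_def)
  with sA show ?thesis
    using assms(1) by (fastforce simp: brace_ideal_def)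
qed

lemma ideal_generated_least:
  assumes "S \<subseteq> carrier X"
  shows "brace_ideal (ideal_generated X S) X" "S \<subseteq> ideal_generated X S"
    and "\<And>I. brace_ideal I X \<Longrightarrow> S \<subseteq> I \<Longrightarrow> ideal_generated X S \<subseteq> I"
  using assms brace_ideal_carrier unfolding ideal_generated_def
  by (auto intro!: brace_ideal_Inter)

end

end

theory Submission
  imports Defs
begin

text \<open>
  Everything rests on one observation: an epimorphism \<open>f : X \<rightarrow> Y\<close> of skew braces maps the
  \<open>n\<close>-th term of the left series of \<open>X\<close> onto the \<open>n\<close>-th term of that of \<open>Y\<close>
  (\<open>brace_epimorphism.image_left_series\<close>). Hence \<open>Y\<close> is left nilpotent exactly when some term of the left
  series of \<open>X\<close> lies in the kernel of \<open>f\<close>. The left series is decreasing, so in a finite skew brace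
  its intersection is one of its terms, and the condition becomes that the final term lies in the
  kernel (\<open>brace_epimorphism.left_nilpotent_iff_final_subset_kernel\<close>).

  For the projection onto \<open>X/I\<close> this says that \<open>X/I\<close> is left nilpotent if and only if \<open>I\<close> contains
  the final term of the left series. So the residual and the ideal generated by the final term are
  intersections of the same family of ideals. The residual is thus itself a member of the family,
  which makes the quotient by it left nilpotent, and it lies in every kernel of an epimorphism onto a
  left-nilpotent skew brace, because such a kernel is also a member. The upper bound by the second term
  of the left series holds because that term is an ideal (\<open>brace_ideal_left_series_2\<close>), and the
  remaining claims follow by taking the ideal \<open>0\<close> or the final term itself as a member of the family.
\<close>

section \<open>Decreasing left series and its final term\<close>

context skew_brace
begin

lemma brace_lambda_closed [simp]:
  "a \<in> carrier X \<Longrightarrow> b \<in> carrier X \<Longrightarrow> brace_lambda X a b \<in> carrier X"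
  by (simp add: brace_lambda_def)

lemma brace_star_closed [simp]:
  "a \<in> carrier X \<Longrightarrow> b \<in> carrier X \<Longrightarrow> brace_star X a b \<in> carrier X"
  by (simp add: brace_star_def a_minus_def)

lemma star_generators_subset:
  "S \<subseteq> carrier X \<Longrightarrow> T \<subseteq> carrier X \<Longrightarrow> {brace_star X s t | s t. s \<in> S \<and> t \<in> T} \<subseteq> carrier X"
  using brace_star_closed by blast

lemma set_star_subgroup:
  assumes "S \<subseteq> carrier X" "T \<subseteq> carrier X"
  shows "subgroup (set_star X S T) (add_monoid X)"
  unfolding set_star_def using A.generate_is_subgroup star_generators_subset[OF assms] by simp

lemma set_star_mono:
  assumes "T \<subseteq> T'"
  shows "set_star X S T \<subseteq> set_star X S T'"
  unfolding set_star_def by (rule A.mono_generate) (use assms in blast)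

lemma left_series_subgroup: "subgroup (left_series X n) (add_monoid X)"
proof (induction n)
  case 0
  show ?case using A.subgroup_self by simp
next
  case (Suc n)
  show ?case
  proof (cases n)
    case 0
    then show ?thesis using A.subgroup_self by simp
  next
    case (Suc m)
    then show ?thesis
      using set_star_subgroup[of "carrier X" "left_series X n"] subgroup.subset[OF Suc.IH]
      by simp
  qed
qed

lemma left_series_closed: "left_series X n \<subseteq> carrier X"
  using subgroup.subset[OF left_series_subgroup] by simp

lemma zero_in_left_series: "\<zero> \<in> left_series X n"
  using subgroup.one_closed[OF left_series_subgroup] by simp

lemma left_series_Suc_subset: "left_series X (Suc n) \<subseteq> left_series X n"
proof (induction n)
  case 0
  show ?case by simp
next
  case (Suc n)
  then show ?case
    using left_series_closed[of "Suc (Suc n)"] set_star_mono by (cases n) auto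
qed

lemma left_series_antimono: "m \<le> n \<Longrightarrow> left_series X n \<subseteq> left_series X m"
  using lift_Suc_antimono_le[of "left_series X"] left_series_Suc_subset by blast

lemma left_series_final_is_term:
  assumes "finite (carrier X)"
  obtains N where "N \<ge> 1" "left_series_final X = left_series X N"
proof -
  \<comment> \<open>A term of least cardinality has no proper subset further down the series.\<close>
  obtain N where N: "N \<ge> 1"
    and min: "\<And>n. n \<ge> 1 \<Longrightarrow> card (left_series X N) \<le> card (left_series X n)"
    using ex_has_least_nat[of "\<lambda>n. n \<ge> 1" 1 "\<lambda>n. card (left_series X n)"] by auto
  have "left_series X N \<subseteq> left_series X n" if n: "n \<ge> 1" for n
  proof (cases "n \<le> N")
    case True
    then show ?thesis by (rule left_series_antimono)
  next
    case False
    then have "left_series X n \<subseteq> left_series X N" by (simp add: left_series_antimono)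
    moreover have "finite (left_series X N)"
      using finite_subset[OF left_series_closed assms] .
    ultimately show ?thesis using min[OF n] card_seteq by blast
  qed
  then have "left_series_final X = left_series X N"
    using N by (auto simp: left_series_final_def)
  with N show ?thesis by (rule that)
qed

lemma left_series_final_closed: "left_series_final X \<subseteq> carrier X"
  unfolding left_series_final_def using left_series_closed[of 1] by force

lemma left_series_final_subset_iff:
  assumes "finite (carrier X)"
  shows "left_series_final X \<subseteq> S \<longleftrightarrow> (\<exists>n\<ge>1. left_series X n \<subseteq> S)"
proof
  assume "left_series_final X \<subseteq> S"
  then show "\<exists>n\<ge>1. left_series X n \<subseteq> S"
    using left_series_final_is_term[OF assms] by metis
next
  assume "\<exists>n\<ge>1. left_series X n \<subseteq> S"
  then show "left_series_final X \<subseteq> S"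
    unfolding left_series_final_def by fastforce
qed

section \<open>Ideals\<close>

lemma mult_zero_right: "a \<in> carrier X \<Longrightarrow> a \<otimes> \<zero> = a"
  using M.r_one one_eq_zero by metis

lemma brace_ideal_zero: "brace_ideal {\<zero>} X"
proof -
  have "{\<zero>} \<lhd> add_monoid X" "{\<zero>} \<lhd> X"
    using A.one_is_normal M.one_is_normal by (simp_all add: one_eq_zero)
  moreover have "brace_lambda X a \<zero> = \<zero>" if "a \<in> carrier X" for a
    using that by (simp add: brace_lambda_def mult_zero_right)
  ultimately show ?thesis
    by (auto simp: brace_ideal_def normal_imp_subgroup)
qed

lemma brace_lambda_eq_star_add:
  assumes "a \<in> carrier X" "b \<in> carrier X"
  shows "brace_lambda X a b = brace_star X a b \<oplus> b"
  using assms by (simp add: brace_star_def a_minus_def A.m_assoc)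

lemma mult_eq_add_star_add:
  assumes "a \<in> carrier X" "b \<in> carrier X"
  shows "a \<otimes> b = a \<oplus> (brace_star X a b \<oplus> b)"
  using assms by (simp add: mult_eq_add_lambda brace_lambda_eq_star_add)

lemma brace_lambda_add:
  assumes "a \<in> carrier X" "b \<in> carrier X" "c \<in> carrier X"
  shows "brace_lambda X a (b \<oplus> c) = brace_lambda X a b \<oplus> brace_lambda X a c"
  using assms by (simp add: brace_lambda_def skew_distrib a_minus_def A.m_assoc)

text \<open>
  Solved for the second summand on the right, this writes an additive conjugate of \<open>a * c\<close> in terms
  of values of the star operation. This is why \<open>X * X\<close> is normal in the additive group.
\<close>

lemma brace_star_add:
  assumes "a \<in> carrier X" "b \<in> carrier X" "c \<in> carrier X"
  shows "brace_star X a (b \<oplus> c) = brace_star X a b \<oplus> (b \<oplus> brace_star X a c \<ominus> b)"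
proof -
  have "\<ominus> b \<oplus> (b \<oplus> x) = x" if "x \<in> carrier X" for x
    using assms that by (simp add: A.m_assoc[symmetric])
  then show ?thesis
    using assms
    by (simp add: brace_star_def brace_lambda_add a_minus_def A.m_assoc A.inv_mult_group)
qed

text \<open>
  Conjugation is an additive automorphism, so only the generators \<open>a * c\<close> of \<open>X * X\<close> need the identity
  above; the induction over the generated subgroup carries the result to all elements.
\<close>

lemma add_normal_set_star:
  "set_star X (carrier X) (carrier X) \<lhd> add_monoid X"
proof -
  let ?G = "{brace_star X s t | s t. s \<in> carrier X \<and> t \<in> carrier X}"
  let ?N = "set_star X (carrier X) (carrier X)"
  have sub: "subgroup ?N (add_monoid X)" by (rule set_star_subgroup) auto
  have gen: "brace_star X a b \<in> ?N" if "a \<in> carrier X" "b \<in> carrier X" for a b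
    unfolding set_star_def by (rule generate.incl) (use that in auto)
  have conj: "b \<oplus> brace_star X a c \<oplus> \<ominus> b \<in> ?N"
    if abc: "a \<in> carrier X" "b \<in> carrier X" "c \<in> carrier X" for a b c
  proof -
    have "b \<oplus> brace_star X a c \<oplus> \<ominus> b = \<ominus> brace_star X a b \<oplus> brace_star X a (b \<oplus> c)"
      using abc by (simp add: brace_star_add a_minus_def A.m_assoc[symmetric])
    moreover have "\<ominus> brace_star X a b \<in> ?N"
      using subgroup.m_inv_closed[OF sub gen[of a b]] abc by (simp add: a_inv_def)
    ultimately show ?thesis
      using subgroup.m_closed[OF sub] gen abc by simp
  qed
  have "b \<oplus> x \<oplus> \<ominus> b \<in> ?N" if b: "b \<in> carrier X" and x: "x \<in> ?N" for b x
    using x unfolding set_star_def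
  proof (rule generate.induct)
    show "b \<oplus> \<one>\<^bsub>add_monoid X\<^esub> \<oplus> \<ominus> b \<in> generate (add_monoid X) ?G"
      using b subgroup.one_closed[OF sub] by (simp add: set_star_def)
  next
    fix h assume "h \<in> ?G"
    then show "b \<oplus> h \<oplus> \<ominus> b \<in> generate (add_monoid X) ?G"
      using conj b by (auto simp: set_star_def)
  next
    fix h assume h: "h \<in> ?G"
    then have hc: "h \<in> carrier X" by auto
    have "\<ominus> (b \<oplus> h \<oplus> \<ominus> b) \<in> ?N"
      using subgroup.m_inv_closed[OF sub, of "b \<oplus> h \<oplus> \<ominus> b"] conj b h
      by (auto simp: a_inv_def)
    then show "b \<oplus> inv\<^bsub>add_monoid X\<^esub> h \<oplus> \<ominus> b \<in> generate (add_monoid X) ?G"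
      using b hc by (simp add: set_star_def A.inv_mult_group A.m_assoc a_inv_def[symmetric])
  next
    fix h k
    assume h: "h \<in> generate (add_monoid X) ?G" and k: "k \<in> generate (add_monoid X) ?G"
      and IH: "b \<oplus> h \<oplus> \<ominus> b \<in> generate (add_monoid X) ?G" "b \<oplus> k \<oplus> \<ominus> b \<in> generate (add_monoid X) ?G"
    have c: "h \<in> carrier X" "k \<in> carrier X"
      using h k subgroup.subset[OF sub] by (auto simp: set_star_def)
    have "\<ominus> b \<oplus> (b \<oplus> y) = y" if "y \<in> carrier X" for y
      using b that by (simp add: A.m_assoc[symmetric])
    then have "b \<oplus> (h \<oplus> k) \<oplus> \<ominus> b = (b \<oplus> h \<oplus> \<ominus> b) \<oplus> (b \<oplus> k \<oplus> \<ominus> b)"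
      using b c by (simp add: A.m_assoc)
    moreover have "(b \<oplus> h \<oplus> \<ominus> b) \<oplus> (b \<oplus> k \<oplus> \<ominus> b) \<in> ?N"
      using subgroup.m_closed[OF sub] IH by (simp add: set_star_def)
    ultimately show "b \<oplus> (h \<otimes>\<^bsub>add_monoid X\<^esub> k) \<oplus> \<ominus> b \<in> generate (add_monoid X) ?G"
      by (simp add: set_star_def)
  qed
  then show ?thesis
    using A.normal_inv_iff[of ?N] sub by simp
qed

text \<open>
  Since \<open>a b = a + a * b + b\<close>, the two operations agree modulo a normal subgroup of the additive
  group that contains all \<open>a * b\<close>. Such a subgroup is therefore also the kernel of a homomorphism
  from the multiplicative group, namely into the additive quotient group.
\<close>

lemma brace_ideal_if_contains_stars:
  assumes N: "N \<lhd> add_monoid X"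
    and star: "\<And>a b. a \<in> carrier X \<Longrightarrow> b \<in> carrier X \<Longrightarrow> brace_star X a b \<in> N"
  shows "brace_ideal N X"
proof -
  interpret N: normal N "add_monoid X" by (rule N)
  have NX: "N \<subseteq> carrier X" using N.subset by simp
  let ?Q = "add_monoid X Mod N"
  let ?p = "\<lambda>a. N +> a"
  have add: "N +> (a \<oplus> b) = (N +> a) <+> (N +> b)" if "a \<in> carrier X" "b \<in> carrier X" for a b
    using N.rcos_sum[of a b] that by (simp add: a_r_coset_def set_add_def)
  have absorb: "N +> (n \<oplus> b) = N +> b" if "n \<in> N" "b \<in> carrier X" for n b
    using A.coset_mult_assoc[of N n b] A.coset_join2[of n N] N.subgroup_axioms that NX
    by (auto simp: a_r_coset_def)
  have "N +> (a \<otimes> b) = (N +> a) <+> (N +> b)" if "a \<in> carrier X" "b \<in> carrier X" for a b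
  proof -
    have "N +> (a \<otimes> b) = (N +> a) <+> (N +> (brace_star X a b \<oplus> b))"
      using that by (simp add: mult_eq_add_star_add add)
    then show ?thesis using absorb[of "brace_star X a b" b] star that by simp
  qed
  then have hom: "?p \<in> hom X ?Q"
    by (intro homI) (auto simp: FactGroup_def RCOSETS_def a_r_coset_def set_add_def)
  have "kernel X ?Q ?p = N"
  proof -
    have "N +> a = N \<longleftrightarrow> a \<in> N" if "a \<in> carrier X" for a
      using that A.coset_join1[of N a] A.coset_join2[of a N] N.subgroup_axioms NX
      by (auto simp: a_r_coset_def)
    then show ?thesis using NX by (auto simp: kernel_def FactGroup_def)
  qed
  moreover have "kernel X ?Q ?p \<lhd> X"
    using hom N.factorgroup_is_group mult_group
    by (intro group_hom.normal_kernel) (simp add: group_hom_def group_hom_axioms_def)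
  ultimately have "N \<lhd> X" by simp
  moreover have "brace_lambda X a b \<in> N" if "a \<in> carrier X" "b \<in> N" for a b
  proof -
    have "b \<in> carrier X" using that NX by blast
    then show ?thesis
      using that star[of a b] N.m_closed[of "brace_star X a b" b]
      by (simp add: brace_lambda_eq_star_add)
  qed
  ultimately show ?thesis
    using N N.subgroup_axioms by (auto simp: brace_ideal_def)
qed

lemma brace_ideal_left_series_2: "brace_ideal (left_series X 2) X"
proof -
  have "left_series X 2 = set_star X (carrier X) (carrier X)"
    by (simp add: numeral_2_eq_2)
  moreover have "brace_star X a b \<in> set_star X (carrier X) (carrier X)"
    if "a \<in> carrier X" "b \<in> carrier X" for a b
    unfolding set_star_def by (rule generate.incl) (use that in auto)
  ultimately show ?thesis
    using brace_ideal_if_contains_stars[OF add_normal_set_star] by simp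
qed

end

section \<open>Epimorphisms of skew braces\<close>

locale brace_epimorphism =
  X: skew_brace X + Y: skew_brace Y
  for X :: "('a, 'm) ring_scheme" and Y :: "('b, 'n) ring_scheme" +
  fixes f
  assumes f_epi: "f \<in> brace_epi X Y"
begin

lemma group_hom_add: "group_hom (add_monoid X) (add_monoid Y) f"
  using f_epi X.add_group Y.add_group
  by (auto simp: brace_epi_def epi_def group_hom_def group_hom_axioms_def)

lemma group_hom_mult: "group_hom X Y f"
  using f_epi X.mult_group Y.mult_group
  by (auto simp: brace_epi_def epi_def group_hom_def group_hom_axioms_def)

lemma image_carrier: "f ` carrier X = carrier Y"
  using f_epi by (simp add: brace_epi_def epi_def)

lemma closed: "a \<in> carrier X \<Longrightarrow> f a \<in> carrier Y"
  using image_carrier by blast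

lemma map_lambda:
  assumes "a \<in> carrier X" "b \<in> carrier X"
  shows "f (brace_lambda X a b) = brace_lambda Y (f a) (f b)"
  using assms group_hom.hom_mult[OF group_hom_add] group_hom.hom_inv[OF group_hom_add]
    group_hom.hom_mult[OF group_hom_mult]
  by (simp add: brace_lambda_def a_inv_def[symmetric])

lemma map_star:
  assumes "a \<in> carrier X" "b \<in> carrier X"
  shows "f (brace_star X a b) = brace_star Y (f a) (f b)"
  using assms map_lambda group_hom.hom_mult[OF group_hom_add] group_hom.hom_inv[OF group_hom_add]
  by (simp add: brace_star_def a_minus_def a_inv_def[symmetric])

lemma image_set_star:
  assumes "S \<subseteq> carrier X" "T \<subseteq> carrier X"
  shows "f ` set_star X S T = set_star Y (f ` S) (f ` T)"
proof -
  let ?G = "{brace_star X s t | s t. s \<in> S \<and> t \<in> T}"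
  have "f ` ?G = {brace_star Y u v | u v. u \<in> f ` S \<and> v \<in> f ` T}"
  proof -
    have "f (brace_star X s t) = brace_star Y (f s) (f t)" if "s \<in> S" "t \<in> T" for s t
      using that assms map_star by blast
    then show ?thesis by (force simp: image_iff)
  qed
  then show ?thesis
    using group_hom.generate_img[OF group_hom_add, of ?G] X.star_generators_subset[OF assms]
    by (simp add: set_star_def)
qed

text \<open>
  Surjectivity enters in every step, since the left factor of each term is the whole skew brace.
\<close>

lemma image_left_series: "f ` left_series X n = left_series Y n"
proof (induction n)
  case 0
  show ?case using image_carrier by simp
next
  case (Suc n)
  then show ?case
    using image_carrier image_set_star[of "carrier X" "left_series X n"] X.left_series_closed
    by (cases n) auto
qed

lemma brace_ideal_kernel: "brace_ideal (a_kernel X Y f) X"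
proof -
  let ?K = "a_kernel X Y f"
  have K: "?K = {x \<in> carrier X. f x = \<zero>\<^bsub>Y\<^esub>}"
    by (simp add: a_kernel_def kernel_def)
  have nA: "?K \<lhd> add_monoid X"
    using group_hom.normal_kernel[OF group_hom_add] by (simp add: a_kernel_def)
  have "?K = kernel X Y f"
    unfolding K by (simp add: kernel_def Y.one_eq_zero)
  then have nM: "?K \<lhd> X"
    using group_hom.normal_kernel[OF group_hom_mult] by simp
  have "brace_lambda X a b \<in> ?K" if "a \<in> carrier X" "b \<in> ?K" for a b
    using that closed[of a]
    by (simp add: K map_lambda brace_lambda_def[of Y] Y.mult_zero_right)
  then show ?thesis
    using nA nM normal_imp_subgroup[OF nA] by (auto simp: brace_ideal_def)
qed

text \<open>
  Both sides say that \<open>f\<close> sends some term of the left series of \<open>X\<close> to \<open>0\<close>: the left side because the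
  images are the terms of the left series of \<open>Y\<close>, the right side because in the finite case the final
  term occurs in the series.
\<close>

lemma left_nilpotent_iff_final_subset_kernel:
  assumes "finite (carrier X)"
  shows "left_nilpotent Y \<longleftrightarrow> left_series_final X \<subseteq> a_kernel X Y f"
proof -
  have "left_series Y n = {\<zero>\<^bsub>Y\<^esub>} \<longleftrightarrow> left_series X n \<subseteq> a_kernel X Y f" for n
    using X.left_series_closed[of n] Y.zero_in_left_series[of n]
    unfolding image_left_series[symmetric] a_kernel_def kernel_def by auto
  then show ?thesis
    by (simp add: left_nilpotent_def X.left_series_final_subset_iff[OF assms])
qed

end

section \<open>Left-nilpotent quotients\<close>

context skew_brace
begin

lemma quotient_map_epi:
  assumes I: "brace_ideal I X"
  shows "brace_epimorphism X (X Quot I) ((+>) I)"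
proof -
  interpret NA: normal I "add_monoid X" using I by (simp add: brace_ideal_def)
  interpret Q: skew_brace "X Quot I" by (rule quotient_skew_brace[OF I])
  have car: "carrier (X Quot I) = (+>) I ` carrier X"
    by (auto simp: FactRing_def A_RCOSETS_def RCOSETS_def a_r_coset_def)
  have self: "x \<in> I +> x" if "x \<in> carrier X" for x
    using that A.rcos_self[of x I] NA.subgroup_axioms by (simp add: a_r_coset_def)
  have add: "(I +> x) \<oplus>\<^bsub>X Quot I\<^esub> (I +> y) = I +> (x \<oplus> y)"
    if "x \<in> carrier X" "y \<in> carrier X" for x y
    using that NA.rcos_sum[of x y] by (simp add: FactRing_def a_r_coset_def set_add_def)
  have mult: "(I +> x) \<otimes>\<^bsub>X Quot I\<^esub> (I +> y) = I +> (x \<otimes> y)"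
    if x: "x \<in> carrier X" and y: "y \<in> carrier X" for x y
  proof -
    \<comment> \<open>The product is a coset because the quotient is closed under multiplication, and it
      contains \<open>x \<otimes> y\<close>, which determines it.\<close>
    have "(I +> x) \<otimes>\<^bsub>X Quot I\<^esub> (I +> y) \<in> carrier (X Quot I)"
      by (rule Q.M.m_closed) (use x y car in auto)
    then obtain z where z: "z \<in> carrier X" "(I +> x) \<otimes>\<^bsub>X Quot I\<^esub> (I +> y) = I +> z"
      using car by auto
    have "x \<otimes> y \<in> rcoset_mult X I (I +> x) (I +> y)"
      using self[OF x] self[OF y] self[OF M.m_closed[OF x y]] by (auto simp: rcoset_mult_def)
    then have "x \<otimes> y \<in> I +> z" using z(2) by (simp add: FactRing_def)
    then show ?thesis
      using z A.repr_independence[of "x \<otimes> y" I z] NA.subgroup_axioms by (simp add: a_r_coset_def)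
  qed
  have "(+>) I \<in> brace_epi X (X Quot I)"
    using car add mult by (auto simp: brace_epi_def epi_def hom_def)
  then show ?thesis
    by (intro brace_epimorphism.intro brace_epimorphism_axioms.intro skew_brace_axioms Q.skew_brace_axioms)
qed

lemma kernel_quotient_map:
  assumes I: "brace_ideal I X"
  shows "a_kernel X (X Quot I) ((+>) I) = I"
proof -
  have sub: "subgroup I (add_monoid X)" using I by (simp add: brace_ideal_def)
  have "I +> a = I \<longleftrightarrow> a \<in> I" if "a \<in> carrier X" for a
    using that A.coset_join1[of I a] A.coset_join2[of a I] sub subgroup.subset[OF sub]
    by (auto simp: a_r_coset_def)
  then show ?thesis
    using subgroup.subset[OF sub] by (auto simp: a_kernel_def kernel_def FactRing_def)
qed

lemma left_nilpotent_quotient_iff: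
  assumes "finite (carrier X)" "brace_ideal I X"
  shows "left_nilpotent (X Quot I) \<longleftrightarrow> left_series_final X \<subseteq> I"
  using brace_epimorphism.left_nilpotent_iff_final_subset_kernel[OF quotient_map_epi]
    kernel_quotient_map assms by simp

lemma left_nilpotent_iff_final_zero:
  assumes "finite (carrier X)"
  shows "left_nilpotent X \<longleftrightarrow> left_series_final X \<subseteq> {\<zero>}"
  using left_series_final_subset_iff[OF assms, of "{\<zero>}"] zero_in_left_series
  by (fastforce simp: left_nilpotent_def)

lemma left_nilpotent_residual_eq_ideal_generated:
  assumes "finite (carrier X)"
  shows "left_nilpotent_residual X = ideal_generated X (left_series_final X)"
proof -
  have "{I. brace_ideal I X \<and> left_nilpotent (X Quot I)}
      = {I. brace_ideal I X \<and> left_series_final X \<subseteq> I}"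
    using left_nilpotent_quotient_iff[OF assms] by blast
  then show ?thesis by (simp add: left_nilpotent_residual_def ideal_generated_def)
qed

end

theorem theorem5p3:
  fixes X :: "('a, 'm) ring_scheme"
  assumes "skew_brace X"
    and "finite (carrier X)"
  shows "left_nilpotent_residual X = ideal_generated X (left_series_final X)
    \<and> (left_nilpotent (X Quot left_nilpotent_residual X)
        \<and> (\<forall>(Y :: ('b, 'n) ring_scheme) f.
              skew_brace Y \<and> f \<in> brace_epi X Y \<and> left_nilpotent Y
                \<longrightarrow> left_nilpotent_residual X \<subseteq> a_kernel X Y f))
    \<and> (left_series_final X \<subseteq> left_nilpotent_residual X
        \<and> left_nilpotent_residual X \<subseteq> left_series X 2)
    \<and> ((left_nilpotent_residual X = {\<zero>\<^bsub>X\<^esub>} \<longleftrightarrow> left_nilpotent X)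
        \<and> (left_nilpotent_residual X = left_series_final X
            \<longleftrightarrow> brace_ideal (left_series_final X) X))"
proof -
  interpret skew_brace X by (rule assms(1))
  let ?R = "left_nilpotent_residual X"
  let ?L = "left_series_final X"
  have R: "?R = ideal_generated X ?L"
    using left_nilpotent_residual_eq_ideal_generated assms(2) .
  have ideal: "brace_ideal ?R X" and LR: "?L \<subseteq> ?R"
    and least: "\<And>I. brace_ideal I X \<Longrightarrow> ?L \<subseteq> I \<Longrightarrow> ?R \<subseteq> I"
    using ideal_generated_least[OF left_series_final_closed] R by simp_all
  have zero: "\<zero>\<^bsub>X\<^esub> \<in> ?R"
    using ideal subgroup.one_closed by (fastforce simp: brace_ideal_def)
  have "left_nilpotent (X Quot ?R)"
    using left_nilpotent_quotient_iff[OF assms(2) ideal] LR by simp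
  moreover have "?R \<subseteq> a_kernel X Y f"
    if "skew_brace Y" "f \<in> brace_epi X Y" "left_nilpotent Y" for Y :: "('b, 'n) ring_scheme" and f
  proof -
    interpret f: brace_epimorphism X Y f
      using that(1,2) assms(1) by (intro brace_epimorphism.intro brace_epimorphism_axioms.intro)
    show ?thesis
      using least f.brace_ideal_kernel f.left_nilpotent_iff_final_subset_kernel assms(2) that(3)
      by blast
  qed
  moreover have "?R \<subseteq> left_series X 2"
    using least[OF brace_ideal_left_series_2] by (force simp: left_series_final_def)
  moreover have "?R = {\<zero>\<^bsub>X\<^esub>} \<longleftrightarrow> left_nilpotent X"
    using least[OF brace_ideal_zero] LR zero left_nilpotent_iff_final_zero[OF assms(2)] by blast
  moreover have "?R = ?L \<longleftrightarrow> brace_ideal ?L X"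
    using ideal least[of ?L] LR by auto
  ultimately show ?thesis using R LR by blast
qed

end
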